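(* Let $G$ be a finite graph cellularly embedded in a compact, connected, orientable, boundaryless surface $\Sigma$ of genus $g\ge 0$, with dual graph $G^*$ and positive coupling constants $(J_{e^*})_{e^*\in E^*}$. The double Ising partition function can be rewritten as $$Z_{\mathrm{d\text{-}Ising}}(G^*,J)=\mathcal{C}_{\mathrm I}\sum_{\substack{(P,P^* )\in\mathcal P^0(G)\times\mathcal P^0(G^* )\\ P\cap P^*=\emptyset}}\Bigl(\prod_{e\in P}\frac{2e^{-2J_{e^*}}}{1+e^{-4J_{e^*}}}\Bigr)\Bigl(\prod_{e^*\in P^*}\frac{1-e^{-4J_{e^*}}}{1+e^{-4J_{e^*}}}\Bigr),$$ where $\mathcal C_{\mathrm I}=2^{|V^*|+2g+1}\prod_{e\in E}\cosh(2J_{e^*})$, and where the primal polygon configurations of $\mathcal P^0(G)$ are the XOR loop configurations, i.e. for each $P\in\mathcal P^0(G)$ the terms of the right-hand side (including the factor $\mathcal C_{\mathrm I}$) with first component $P$ sum to the contribution to $Z_{\mathrm{d\text{-}Ising}}(G^*,J)$ of the pairs $(P_{\mathrm{red}},P_{\mathrm{blue}})$ with $\mathrm{XOR}(P_{\mathrm{red}},P_{\mathrm{blue}})=P$.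
   Context: Graphs: $G=(V,E)$, $G^*=(V^*,E^* )$, and $e\mapsto e^*$ is the bijection between edges and dual edges. A polygon configuration of $G$ (resp. $G^*$) is a subset of edges such that every vertex is incident to an even number of them. For $\epsilon\in H_1(\Sigma;\mathbb Z/2\mathbb Z)$, $\mathcal P^\epsilon(G)$ (resp. $\mathcal P^\epsilon(G^* )$) is the set of polygon configurations of $G$ (resp. $G^*$) with homology class $\epsilon$. $P\cap P^*=\emptyset$ means that there is no edge $e\in P$ with $e^*\in P^*$. Double Ising model: for each $\epsilon\in H_1(\Sigma;\mathbb Z/2\mathbb Z)$ fix a representative $\underline\epsilon\subset E$, and put $s_\epsilon(e)=-1$ if $e\in\underline\epsilon$, $s_\epsilon(e)=1$ otherwise. The Ising partition function with defect condition $\epsilon$ is $Z^\epsilon_{\mathrm{Ising}}(G^*,J)=\sum_{\sigma\in\{-1,1\}^{V^*}}\exp\bigl(\sum_{e^*=u^*v^*\in E^*}s_\epsilon(e)J_{e^*}\sigma_{u^*}\sigma_{v^*}\bigr)$ (independent of the representative). The double Ising partition function is $$Z_{\mathrm{d\text{-}Ising}}(G^*,J)=\sum_{\epsilon}\bigl(Z^\epsilon_{\mathrm{Ising}}(G^*,J)\bigr)^2=\sum_{\epsilon}\ \sum_{(P_{\mathrm{red}},P_{\mathrm{blue}})\in\mathcal P^\epsilon(G)\times\mathcal P^\epsilon(G)}\mathcal C\prod_{e\in P_{\mathrm{red}}}e^{-2J_{e^*}}\prod_{e\in P_{\mathrm{blue}}}e^{-2J_{e^*}},\qquad \mathcal C=\Bigl(2\prod_{e\in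 E}e^{J_{e^*}}\Bigr)^2 .$$ The polygon configuration of a spin configuration $\sigma$ with defect $\epsilon$ is $\{e\in E: s_\epsilon(e)\sigma_{u^*}\sigma_{v^*}=-1,\ e^*=u^*v^*\}$. A pair $(P_{\mathrm{red}},P_{\mathrm{blue}})\in\mathcal P^\epsilon(G)^2$ is realized by spin configurations $(\pm\sigma,\pm\sigma')$ with defect $\epsilon$; $\mathrm{XOR}(P_{\mathrm{red}},P_{\mathrm{blue}})\subset E$ is the set of edges $e$ such that the XOR-spin $\sigma\sigma'$ takes distinct values at the endpoints of $e^*$ (this does not depend on choices). *)

theory Defs
  imports
    Complex_Main
    "HOL-Library.FuncSet"
    "HOL-Library.Disjoint_Sets"
    "HOL-Combinatorics.Orbits"
    "HOL-Algebra.Coset"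
    "Graph_Theory.Bidirected_Digraph"
    "Graph_Theory.Digraph_Component"
begin

section \<open>Graphs cellularly embedded in closed oriented surfaces\<close>

text \<open>
  A finite graph cellularly embedded in a compact, connected, oriented surface without boundary is
  represented by its rotation system (combinatorial map). The arcs of the skeleton are the
  half-edges (darts): every edge of the graph is a pair of mutually reverse arcs \<open>a\<close>, \<open>opp M a\<close>,
  and \<open>rot M a\<close> is the next arc leaving the vertex \<open>tail a\<close> in the cyclic order given by the
  orientation of the surface. Loops and parallel edges are allowed. Connectedness of the skeleton
  expresses that the surface is connected.
\<close>

record ('v, 'd) rotation_system =
  skeleton :: "('v, 'd) pre_digraph"
  opp :: "'d \<Rightarrow> 'd"
  rot :: "'d \<Rightarrow> 'd"

locale embedded_graph =
  fin_digraph "skeleton M" + bidirected_digraph "skeleton M" "opp M"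
  for M :: "('v, 'd) rotation_system" +
  assumes connected_skeleton: "Digraph_Component.connected (skeleton M)"
    and rot_permutes: "rot M permutes arcs (skeleton M)"
    and rot_cyclic: "\<And>v. v \<in> verts (skeleton M) \<Longrightarrow> out_arcs (skeleton M) v \<noteq> {} \<Longrightarrow>
      cyclic_on (rot M) (out_arcs (skeleton M) v)"

abbreviation vertices :: "('v, 'd) rotation_system \<Rightarrow> 'v set" where
  "vertices M \<equiv> verts (skeleton M)"

abbreviation darts :: "('v, 'd) rotation_system \<Rightarrow> 'd set" where
  "darts M \<equiv> arcs (skeleton M)"

definition edge_of :: "('v, 'd) rotation_system \<Rightarrow> 'd \<Rightarrow> 'd set" where
  "edge_of M a = {a, opp M a}"

definition edges :: "('v, 'd) rotation_system \<Rightarrow> 'd set set" where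
  "edges M = edge_of M ` darts M"

text \<open>
  The face incident to a dart is the orbit of the dart under the face permutation. The graph with
  one vertex and no edge is embedded in the sphere with a single face, represented by the empty set
  of darts.
\<close>

definition face_succ :: "('v, 'd) rotation_system \<Rightarrow> 'd \<Rightarrow> 'd" where
  "face_succ M = rot M \<circ> opp M"

definition face_of :: "('v, 'd) rotation_system \<Rightarrow> 'd \<Rightarrow> 'd set" where
  "face_of M a = orbit (face_succ M) a"

definition faces :: "('v, 'd) rotation_system \<Rightarrow> 'd set set" where
  "faces M = (if darts M = {} then {{}} else face_of M ` darts M)"

definition euler_characteristic :: "('v, 'd) rotation_system \<Rightarrow> int" where
  "euler_characteristic M = int (card (vertices M)) - int (card (edges M)) + int (card (faces M))"

definition has_genus :: "('v, 'd) rotation_system \<Rightarrow> nat \<Rightarrow> bool" where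
  "has_genus M g \<longleftrightarrow> euler_characteristic M = 2 - 2 * int g"

text \<open>
  The dual graph has the faces as vertices. A dual edge is carried by the same pair of darts as the
  primal edge it crosses, so the bijection \<open>e \<mapsto> e*\<close> is the identity of \<open>edges M = edges (dual M)\<close>.
  The dual edge of \<open>{a, opp M a}\<close> joins the two faces incident to \<open>a\<close> and to \<open>opp M a\<close>.
\<close>

definition dual :: "('v, 'd) rotation_system \<Rightarrow> ('d set, 'd) rotation_system" where
  "dual M =
    \<lparr> skeleton = \<lparr> verts = faces M, arcs = darts M,
                   tail = face_of M, head = (\<lambda>a. face_of M (opp M a)) \<rparr>,
      opp = opp M, rot = face_succ M \<rparr>"

section \<open>Polygon configurations and first homology modulo 2\<close>

text \<open>Edges are counted with multiplicity: a loop contributes two darts at its vertex.\<close>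

definition polygon_config :: "('v, 'd) rotation_system \<Rightarrow> 'd set set \<Rightarrow> bool" where
  "polygon_config M P \<longleftrightarrow> P \<subseteq> edges M \<and>
    (\<forall>v \<in> vertices M. even (card {a \<in> out_arcs (skeleton M) v. edge_of M a \<in> P}))"

text \<open>
  Subsets of edges are cellular 1-chains with coefficients in \<open>\<int>/2\<int>\<close>, with symmetric difference as
  addition, and polygon configurations are the 1-cycles. The boundary of a set \<open>W\<close> of faces is the
  set of edges that are traversed an odd number of times by the boundary walks of the faces in \<open>W\<close>.
\<close>

definition face_boundary :: "('v, 'd) rotation_system \<Rightarrow> 'd set set \<Rightarrow> 'd set set" where
  "face_boundary M W = {e \<in> edges M. odd (card {a \<in> e. face_of M a \<in> W})}"

definition boundaries :: "('v, 'd) rotation_system \<Rightarrow> 'd set set set" where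
  "boundaries M = face_boundary M ` Pow (faces M)"

definition cycle_group :: "('v, 'd) rotation_system \<Rightarrow> 'd set set monoid" where
  "cycle_group M =
    \<lparr> carrier = {P. polygon_config M P}, mult = (\<lambda>P Q. sym_diff P Q), one = {} \<rparr>"

definition H1 :: "('v, 'd) rotation_system \<Rightarrow> 'd set set set monoid" where
  "H1 M = cycle_group M Mod boundaries M"

definition homology_class :: "('v, 'd) rotation_system \<Rightarrow> 'd set set \<Rightarrow> 'd set set set" where
  "homology_class M P = boundaries M #>\<^bsub>cycle_group M\<^esub> P"

definition polygons :: "('v, 'd) rotation_system \<Rightarrow> 'd set set set \<Rightarrow> 'd set set set" where
  "polygons M \<epsilon> = {P. polygon_config M P \<and> homology_class M P = \<epsilon>}"

section \<open>Ising and double Ising models\<close>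

definition spins :: "('v, 'd) rotation_system \<Rightarrow> ('v \<Rightarrow> real) set" where
  "spins N = vertices N \<rightarrow>\<^sub>E {-1, 1}"

text \<open>The product of the spins at the two ends of an edge, each of its darts giving one end.\<close>

definition spin_product :: "('v, 'd) rotation_system \<Rightarrow> ('v \<Rightarrow> real) \<Rightarrow> 'd set \<Rightarrow> real" where
  "spin_product N \<sigma> e = (\<Prod>a\<in>e. \<sigma> (tail (skeleton N) a))"

definition defect_sign :: "'d set set \<Rightarrow> 'd set \<Rightarrow> real" where
  "defect_sign R e = (if e \<in> R then -1 else 1)"

text \<open>
  In the following, \<open>J\<close> assigns to a dual edge its coupling constant, and \<open>R\<close> (respectively
  \<open>rep \<epsilon>\<close>) is a representative, in the primal graph, of the homology class of the defect.
\<close>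

definition Z_Ising ::
  "('v, 'd) rotation_system \<Rightarrow> ('d set \<Rightarrow> real) \<Rightarrow> 'd set set \<Rightarrow> real" where
  "Z_Ising M J R = (\<Sum>\<sigma>\<in>spins (dual M).
     exp (\<Sum>e\<in>edges (dual M). defect_sign R e * J e * spin_product (dual M) \<sigma> e))"

definition Z_dIsing ::
  "('v, 'd) rotation_system \<Rightarrow> ('d set \<Rightarrow> real) \<Rightarrow> ('d set set set \<Rightarrow> 'd set set) \<Rightarrow> real" where
  "Z_dIsing M J rep = (\<Sum>\<epsilon>\<in>carrier (H1 M). (Z_Ising M J (rep \<epsilon>))\<^sup>2)"

definition polygon_of_spin ::
  "('v, 'd) rotation_system \<Rightarrow> 'd set set \<Rightarrow> ('d set \<Rightarrow> real) \<Rightarrow> 'd set set" where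
  "polygon_of_spin M R \<sigma> = {e \<in> edges M. defect_sign R e * spin_product (dual M) \<sigma> e = -1}"

text \<open>
  The XOR configuration consists of the edges across which the XOR-spin \<open>\<sigma>\<sigma>'\<close> changes, for spin
  configurations realizing the pair of polygon configurations; see \<open>XOR_eqI\<close> below for the
  independence of the choice of these spin configurations.
\<close>

definition interface :: "('v, 'd) rotation_system \<Rightarrow> ('d set \<Rightarrow> real) \<Rightarrow> 'd set set" where
  "interface M \<tau> = {e \<in> edges M.
     \<exists>a\<in>e. \<tau> (tail (skeleton (dual M)) a) \<noteq> \<tau> (head (skeleton (dual M)) a)}"

definition XOR ::
  "('v, 'd) rotation_system \<Rightarrow> 'd set set \<Rightarrow> 'd set set \<Rightarrow> 'd set set \<Rightarrow> 'd set set" where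
  "XOR M R Pred Pblue = {e. \<exists>\<sigma>\<in>spins (dual M). \<exists>\<sigma>'\<in>spins (dual M).
     polygon_of_spin M R \<sigma> = Pred \<and> polygon_of_spin M R \<sigma>' = Pblue \<and>
     e \<in> interface M (\<lambda>f. \<sigma> f * \<sigma>' f)}"

text \<open>
  The part of the low temperature (polygon) expansion of the double Ising partition function coming
  from the pairs of polygon configurations with a given XOR configuration.
\<close>

definition XOR_contribution ::
  "('v, 'd) rotation_system \<Rightarrow> ('d set \<Rightarrow> real) \<Rightarrow> ('d set set set \<Rightarrow> 'd set set) \<Rightarrow>
   'd set set \<Rightarrow> real" where
  "XOR_contribution M J rep P =
    (\<Sum>\<epsilon>\<in>carrier (H1 M).
      \<Sum>(Pred, Pblue) \<in> {(Pred, Pblue) \<in> polygons M \<epsilon> \<times> polygons M \<epsilon>. XOR M (rep \<epsilon>) Pred Pblue = P}.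
        (2 * (\<Prod>e\<in>edges M. exp (J e)))\<^sup>2 *
        (\<Prod>e\<in>Pred. exp (- 2 * J e)) * (\<Prod>e\<in>Pblue. exp (- 2 * J e)))"

section \<open>The two families of loops\<close>

definition C_I :: "('v, 'd) rotation_system \<Rightarrow> nat \<Rightarrow> ('d set \<Rightarrow> real) \<Rightarrow> real" where
  "C_I M g J = 2 ^ (card (vertices (dual M)) + 2 * g + 1) * (\<Prod>e\<in>edges M. cosh (2 * J e))"

definition loop_weight :: "('d set \<Rightarrow> real) \<Rightarrow> 'd set set \<Rightarrow> 'd set set \<Rightarrow> real" where
  "loop_weight J P Q =
    (\<Prod>e\<in>P. 2 * exp (- 2 * J e) / (1 + exp (- 4 * J e))) *
    (\<Prod>e\<in>Q. (1 - exp (- 4 * J e)) / (1 + exp (- 4 * J e)))"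

section \<open>The definitions are meaningful\<close>

lemma dual_simps [simp]:
  "vertices (dual M) = faces M" "darts (dual M) = darts M"
  "tail (skeleton (dual M)) = face_of M"
  "head (skeleton (dual M)) = (\<lambda>a. face_of M (opp M a))"
  "opp (dual M) = opp M" "rot (dual M) = face_succ M"
  by (simp_all add: dual_def)

lemma edge_of_dual [simp]: "edge_of (dual M) = edge_of M"
  by (simp add: edge_of_def fun_eq_iff)

lemma edges_dual [simp]: "edges (dual M) = edges M"
  by (simp add: edges_def)

context embedded_graph
begin

lemma edge_of_opp [simp]: "edge_of M (opp M a) = edge_of M a"
  by (auto simp: edge_of_def)

lemma finite_edges [simp]: "finite (edges M)"
  by (simp add: edges_def)

lemma face_succ_permutes: "face_succ M permutes darts M"
  unfolding face_succ_def using arev_permutes_arcs rot_permutes by (rule permutes_compose)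

lemma cyclic_on_face_of: "cyclic_on (face_succ M) (face_of M a)"
  unfolding face_of_def using face_succ_permutes by (rule cyclic_on_orbit) simp

lemma self_in_face_of [simp]: "a \<in> face_of M a"
  unfolding face_of_def using face_succ_permutes
  by (intro permutation_self_in_orbit) (auto simp: permutation_permutes intro!: exI[of _ "darts M"])

lemma face_of_eq_iff: "face_of M a = face_of M b \<longleftrightarrow> b \<in> face_of M a"
  by (metis cyclic_on_face_of face_of_def orbit_cyclic_eq3 self_in_face_of)

lemma face_of_opp: "face_of M (opp M a) = face_of M (rot M a)"
  unfolding face_of_eq_iff
  by (metis arev_arev comp_apply cyclic_on_face_of cyclic_on_inI face_succ_def self_in_face_of)

lemma face_of_subset: "a \<in> darts M \<Longrightarrow> face_of M a \<subseteq> darts M"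
  unfolding face_of_def using face_succ_permutes by (rule permutes_orbit_subset)

lemma out_arcs_dual:
  assumes "f \<in> faces M" shows "out_arcs (skeleton (dual M)) f = f"
proof (cases "darts M = {}")
  case True then show ?thesis using assms by (auto simp: faces_def out_arcs_def)
next
  case False
  then obtain b where "b \<in> darts M" "f = face_of M b" using assms by (auto simp: faces_def)
  then show ?thesis
    using face_of_subset[of b] face_of_eq_iff self_in_face_of
    by (auto simp: out_arcs_def) metis+
qed

lemma face_of_in_faces [simp]: "a \<in> darts M \<Longrightarrow> face_of M a \<in> faces M"
  by (auto simp: faces_def)

lemma strongly_connected_skeleton: "strongly_connected (skeleton M)"
  using connected_skeleton sym_arcs by (intro symmetric_connected_imp_strongly_connected)

lemma bidirected_dual: "bidirected_digraph (skeleton (dual M)) (opp (dual M))"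
  using arev_dom by unfold_locales auto

lemma fin_dual: "fin_digraph (skeleton (dual M))"
proof -
  interpret D: bidirected_digraph "skeleton (dual M)" "opp (dual M)" by (rule bidirected_dual)
  show ?thesis by unfold_locales (auto simp: faces_def)
qed

lemma dual_reachable_opp:
  assumes "a \<in> darts M"
  shows "face_of M a \<rightarrow>\<^sup>*\<^bsub>skeleton (dual M)\<^esub> face_of M (opp M a)"
proof -
  interpret D: bidirected_digraph "skeleton (dual M)" "opp (dual M)" by (rule bidirected_dual)
  have "(face_of M a, face_of M (opp M a)) \<in> arcs_ends (skeleton (dual M))"
    using assms unfolding arcs_ends_def arc_to_ends_def by (auto intro!: image_eqI[of _ _ a])
  then show ?thesis by (rule D.reachable_adjI)
qed

lemma dual_reachable_out_arcs:
  assumes "a \<in> darts M" "b \<in> darts M" "tail (skeleton M) a = tail (skeleton M) b"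
  shows "face_of M a \<rightarrow>\<^sup>*\<^bsub>skeleton (dual M)\<^esub> face_of M b"
proof -
  interpret D: bidirected_digraph "skeleton (dual M)" "opp (dual M)" by (rule bidirected_dual)
  let ?S = "out_arcs (skeleton M) (tail (skeleton M) a)"
  have S: "a \<in> ?S" "b \<in> ?S" using assms by auto
  then have "cyclic_on (rot M) ?S" using assms by (intro rot_cyclic) auto
  then have "?S = orbit (rot M) a" using S by (auto simp: cyclic_on_alldef)
  then have "b \<in> orbit (rot M) a" using S by simp
  then have "b \<in> darts M \<and> face_of M a \<rightarrow>\<^sup>*\<^bsub>skeleton (dual M)\<^esub> face_of M b"
  proof induction
    case base
    then show ?case using assms(1) dual_reachable_opp[of a] rot_permutes
      by (simp add: face_of_opp permutes_in_image)
  next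
    case (step y)
    then have "face_of M y \<rightarrow>\<^sup>*\<^bsub>skeleton (dual M)\<^esub> face_of M (rot M y)"
      using dual_reachable_opp[of y] by (simp add: face_of_opp)
    with step show ?case using rot_permutes D.reachable_trans by (auto simp: permutes_in_image)
  qed
  then show ?thesis by simp
qed

lemma dual_reachable:
  assumes "a \<in> darts M" "b \<in> darts M"
  shows "face_of M a \<rightarrow>\<^sup>*\<^bsub>skeleton (dual M)\<^esub> face_of M b"
proof -
  interpret D: bidirected_digraph "skeleton (dual M)" "opp (dual M)" by (rule bidirected_dual)
  have "tail (skeleton M) a \<rightarrow>\<^sup>*\<^bsub>skeleton M\<^esub> tail (skeleton M) b"
    using strongly_connected_skeleton assms by (auto simp: strongly_connected_def)
  moreover have "\<forall>b. b \<in> darts M \<longrightarrow> tail (skeleton M) b = v \<longrightarrow>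
    face_of M a \<rightarrow>\<^sup>*\<^bsub>skeleton (dual M)\<^esub> face_of M b"
    if "tail (skeleton M) a \<rightarrow>\<^sup>*\<^bsub>skeleton M\<^esub> v" for v
    using that
  proof (induction rule: reachable_induct)
    case base
    then show ?case using assms(1) by (auto intro!: dual_reachable_out_arcs)
  next
    case (step x y)
    then obtain c where c: "c \<in> darts M" "tail (skeleton M) c = x" "head (skeleton M) c = y"
      by (auto simp: arcs_ends_def arc_to_ends_def)
    then have "face_of M a \<rightarrow>\<^sup>*\<^bsub>skeleton (dual M)\<^esub> face_of M c" using step by auto
    also have "face_of M c \<rightarrow>\<^sup>*\<^bsub>skeleton (dual M)\<^esub> face_of M (opp M c)"
      using c by (intro dual_reachable_opp)
    finally (D.reachable_trans) have
      ac: "face_of M a \<rightarrow>\<^sup>*\<^bsub>skeleton (dual M)\<^esub> face_of M (opp M c)" .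
    show ?case
    proof (intro allI impI)
      fix d assume "d \<in> darts M" "tail (skeleton M) d = y"
      then have "face_of M (opp M c) \<rightarrow>\<^sup>*\<^bsub>skeleton (dual M)\<^esub> face_of M d"
        using c by (intro dual_reachable_out_arcs) auto
      with ac show "face_of M a \<rightarrow>\<^sup>*\<^bsub>skeleton (dual M)\<^esub> face_of M d"
        by (rule D.reachable_trans)
    qed
  qed
  ultimately show ?thesis using assms by blast
qed

lemma faces_nonempty: "faces M \<noteq> {}"
  by (auto simp: faces_def)

lemma strongly_connected_dual: "strongly_connected (skeleton (dual M))"
proof -
  interpret D: bidirected_digraph "skeleton (dual M)" "opp (dual M)" by (rule bidirected_dual)
  show ?thesis
  proof (cases "darts M = {}")
    case True
    then have "faces M = {{}}" by (simp add: faces_def)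
    then show ?thesis by (auto simp: strongly_connected_def intro!: D.reachable_refl)
  next
    case False
    then have "faces M = face_of M ` darts M" by (simp add: faces_def)
    then show ?thesis using faces_nonempty by (auto simp: strongly_connected_def dual_reachable)
  qed
qed

theorem embedded_graph_dual: "embedded_graph (dual M)"
proof -
  interpret D: bidirected_digraph "skeleton (dual M)" "opp (dual M)" by (rule bidirected_dual)
  interpret D: fin_digraph "skeleton (dual M)" by (rule fin_dual)
  show ?thesis
  proof unfold_locales
    show "Digraph_Component.connected (skeleton (dual M))"
      using strongly_connected_dual
      by (simp add: connected_def strongly_connected_def D.reachable_mk_symmetric_eq D.sym_arcs)
    show "rot (dual M) permutes darts (dual M)" by (simp add: face_succ_permutes)
  next
    fix v assume "v \<in> vertices (dual M)" "out_arcs (skeleton (dual M)) v \<noteq> {}"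
    then show "cyclic_on (rot (dual M)) (out_arcs (skeleton (dual M)) v)"
      using out_arcs_dual[of v] cyclic_on_face_of by (auto simp: faces_def split: if_splits)
  qed
qed

lemma face_boundary_iff:
  assumes "a \<in> darts M"
  shows "edge_of M a \<in> face_boundary M W \<longleftrightarrow>
    (face_of M a \<in> W) \<noteq> (face_of M (opp M a) \<in> W)"
proof -
  have "{b \<in> edge_of M a. face_of M b \<in> W} =
    (if face_of M a \<in> W then {a} else {}) \<union> (if face_of M (opp M a) \<in> W then {opp M a} else {})"
    by (auto simp: edge_of_def)
  then show ?thesis
    using assms arev_neq[of a] by (auto simp: face_boundary_def edges_def)
qed

end

lemma even_card_sym_diff:
  assumes "finite A" "finite B"
  shows "even (card (sym_diff A B)) \<longleftrightarrow> (even (card A) \<longleftrightarrow> even (card B))"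
proof -
  have "card (sym_diff A B) = card (A - B) + card (B - A)"
    using assms by (intro card_Un_disjoint) auto
  moreover have "card A = card (A - B) + card (A \<inter> B)"
    using assms by (metis card_Int_Diff add.commute)
  moreover have "card B = card (B - A) + card (A \<inter> B)"
    using assms by (metis card_Int_Diff add.commute inf_commute)
  ultimately show ?thesis by auto
qed

context embedded_graph
begin

lemma polygon_config_sym_diff:
  assumes "polygon_config M P" "polygon_config M Q"
  shows "polygon_config M (sym_diff P Q)"
  unfolding polygon_config_def
proof (intro conjI ballI)
  show "sym_diff P Q \<subseteq> edges M" using assms by (auto simp: polygon_config_def)
  fix v assume v: "v \<in> vertices M"
  let ?A = "\<lambda>P. {a \<in> out_arcs (skeleton M) v. edge_of M a \<in> P}"
  have "?A (sym_diff P Q) = sym_diff (?A P) (?A Q)" by auto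
  then show "even (card (?A (sym_diff P Q)))"
    using assms v by (simp add: even_card_sym_diff polygon_config_def)
qed

lemma comm_group_cycle_group: "comm_group (cycle_group M)"
proof (rule comm_groupI)
  have e: "polygon_config M {}" by (simp add: polygon_config_def)
  then show "\<one>\<^bsub>cycle_group M\<^esub> \<in> carrier (cycle_group M)" by (simp add: cycle_group_def)
  fix P assume "P \<in> carrier (cycle_group M)"
  then show "\<exists>Q\<in>carrier (cycle_group M). Q \<otimes>\<^bsub>cycle_group M\<^esub> P = \<one>\<^bsub>cycle_group M\<^esub>"
    by (intro bexI[of _ P]) (auto simp: cycle_group_def)
qed (auto simp: cycle_group_def polygon_config_sym_diff)

lemma polygon_config_face_boundary: "polygon_config M (face_boundary M W)"
  unfolding polygon_config_def
proof (intro conjI ballI)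
  show "face_boundary M W \<subseteq> edges M" by (auto simp: face_boundary_def)
  fix v assume v: "v \<in> vertices M"
  let ?S = "out_arcs (skeleton M) v"
  let ?A = "{a \<in> ?S. face_of M a \<in> W}" and ?B = "{a \<in> ?S. face_of M (rot M a) \<in> W}"
  have "{a \<in> ?S. edge_of M a \<in> face_boundary M W} = sym_diff ?A ?B"
    by (auto simp: face_boundary_iff face_of_opp)
  moreover have "card ?B = card ?A"
  proof (cases "?S = {}")
    case False
    have cyc: "cyclic_on (rot M) ?S" using v False by (rule rot_cyclic)
    have "bij_betw (rot M) ?B ?A"
    proof (rule bij_betwI')
      show "(rot M x = rot M y) = (x = y)" for x y
        using permutes_inj[OF rot_permutes] by (auto dest: injD)
      show "rot M x \<in> ?A" if "x \<in> ?B" for x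
        using cyclic_on_inI[OF cyc, of x] that by auto
      show "\<exists>x\<in>?B. y = rot M x" if "y \<in> ?A" for y
      proof -
        obtain x where x: "y = rot M x" using permutes_surj[OF rot_permutes] by (auto elim: surjE)
        moreover have "y \<in> ?S" "face_of M y \<in> W" using that by simp_all
        ultimately have "x \<in> ?B" using cyclic_on_f_in[OF rot_permutes cyc, of x] by simp
        then show ?thesis using x by blast
      qed
    qed
    then show ?thesis by (rule bij_betw_same_card)
  qed simp
  ultimately show "even (card {a \<in> ?S. edge_of M a \<in> face_boundary M W})"
    by (simp add: even_card_sym_diff)
qed

lemma face_boundary_sym_diff:
  "sym_diff (face_boundary M V) (face_boundary M W) = face_boundary M (sym_diff V W)"
proof (rule Set.set_eqI)
  fix e
  show "e \<in> sym_diff (face_boundary M V) (face_boundary M W) \<longleftrightarrow>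
    e \<in> face_boundary M (sym_diff V W)"
  proof (cases "e \<in> edges M")
    case True
    then obtain a where "a \<in> darts M" "e = edge_of M a" by (auto simp: edges_def)
    then show ?thesis using face_boundary_iff[of a] by auto
  qed (auto simp: face_boundary_def)
qed

lemma normal_boundaries: "boundaries M \<lhd> cycle_group M"
proof -
  interpret Z: comm_group "cycle_group M" by (rule comm_group_cycle_group)
  have "subgroup (boundaries M) (cycle_group M)"
  proof (rule Z.subgroupI)
    show "boundaries M \<subseteq> carrier (cycle_group M)"
      by (auto simp: boundaries_def cycle_group_def polygon_config_face_boundary)
    show "boundaries M \<noteq> {}" by (auto simp: boundaries_def)
  next
    fix P assume P: "P \<in> boundaries M"
    then have "P \<in> carrier (cycle_group M)"
      by (auto simp: boundaries_def cycle_group_def polygon_config_face_boundary)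
    moreover have "P \<otimes>\<^bsub>cycle_group M\<^esub> P = \<one>\<^bsub>cycle_group M\<^esub>" by (simp add: cycle_group_def)
    ultimately have "inv\<^bsub>cycle_group M\<^esub> P = P" by (intro Z.inv_equality) auto
    then show "inv\<^bsub>cycle_group M\<^esub> P \<in> boundaries M" using P by simp
  next
    fix P Q assume "P \<in> boundaries M" "Q \<in> boundaries M"
    then obtain V W where "V \<subseteq> faces M" "W \<subseteq> faces M"
      "P = face_boundary M V" "Q = face_boundary M W" by (auto simp: boundaries_def)
    then have "P \<otimes>\<^bsub>cycle_group M\<^esub> Q = face_boundary M (sym_diff V W)" "sym_diff V W \<subseteq> faces M"
      by (auto simp: cycle_group_def face_boundary_sym_diff[symmetric])
    then show "P \<otimes>\<^bsub>cycle_group M\<^esub> Q \<in> boundaries M" by (auto simp: boundaries_def)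
  qed
  then show ?thesis by (rule Z.subgroup_imp_normal)
qed

lemma spin_product_dual:
  assumes "a \<in> darts M"
  shows "spin_product (dual M) \<sigma> (edge_of M a) = \<sigma> (face_of M a) * \<sigma> (face_of M (opp M a))"
  using not_sym[OF arev_neq[OF assms]] by (simp add: spin_product_def edge_of_def)

lemma interface_mult:
  assumes "\<sigma> \<in> spins (dual M)" "\<sigma>' \<in> spins (dual M)"
  shows "interface M (\<lambda>f. \<sigma> f * \<sigma>' f) =
    sym_diff (polygon_of_spin M R \<sigma>) (polygon_of_spin M R \<sigma>')"
proof (rule Set.set_eqI)
  fix e
  show "e \<in> interface M (\<lambda>f. \<sigma> f * \<sigma>' f) \<longleftrightarrow>
    e \<in> sym_diff (polygon_of_spin M R \<sigma>) (polygon_of_spin M R \<sigma>')"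
  proof (cases "e \<in> edges M")
    case True
    then obtain a where a: "a \<in> darts M" "e = edge_of M a" by (auto simp: edges_def)
    have "\<sigma> f = -1 \<or> \<sigma> f = 1" "\<sigma>' f = -1 \<or> \<sigma>' f = 1" if "f \<in> faces M" for f
      using assms that by (auto simp: spins_def PiE_def Pi_def)
    from this[of "face_of M a"] this[of "face_of M (opp M a)"]
    have "\<sigma> (face_of M a) = -1 \<or> \<sigma> (face_of M a) = 1"
      "\<sigma>' (face_of M a) = -1 \<or> \<sigma>' (face_of M a) = 1"
      "\<sigma> (face_of M (opp M a)) = -1 \<or> \<sigma> (face_of M (opp M a)) = 1"
      "\<sigma>' (face_of M (opp M a)) = -1 \<or> \<sigma>' (face_of M (opp M a)) = 1"
      using a by auto
    moreover have "e \<in> interface M (\<lambda>f. \<sigma> f * \<sigma>' f) \<longleftrightarrow>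
      \<sigma> (face_of M a) * \<sigma>' (face_of M a) \<noteq> \<sigma> (face_of M (opp M a)) * \<sigma>' (face_of M (opp M a))"
      unfolding interface_def a(2) using True a(2) by (auto simp: edge_of_def)
    ultimately show ?thesis
      using True spin_product_dual[OF a(1)] a(2) by (auto simp: polygon_of_spin_def defect_sign_def)
  qed (auto simp: interface_def polygon_of_spin_def)
qed

text \<open>The XOR configuration does not depend on the spin configurations realizing the pair.\<close>

lemma XOR_eqI:
  assumes "\<sigma> \<in> spins (dual M)" "\<sigma>' \<in> spins (dual M)"
    and "polygon_of_spin M R \<sigma> = Pred" "polygon_of_spin M R \<sigma>' = Pblue"
  shows "XOR M R Pred Pblue = interface M (\<lambda>f. \<sigma> f * \<sigma>' f)"
proof -
  have "e \<in> sym_diff Pred Pblue" if e: "e \<in> XOR M R Pred Pblue" for e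
  proof -
    obtain \<tau> \<tau>' where \<tau>: "\<tau> \<in> spins (dual M)" "\<tau>' \<in> spins (dual M)"
      "polygon_of_spin M R \<tau> = Pred" "polygon_of_spin M R \<tau>' = Pblue"
      "e \<in> interface M (\<lambda>f. \<tau> f * \<tau>' f)"
      using e unfolding XOR_def by blast
    then show ?thesis using interface_mult[OF \<tau>(1,2), of R] by simp
  qed
  then have "XOR M R Pred Pblue \<subseteq> interface M (\<lambda>f. \<sigma> f * \<sigma>' f)"
    using interface_mult[OF assms(1,2), of R] assms(3,4) by (intro subsetI) simp
  moreover have "interface M (\<lambda>f. \<sigma> f * \<sigma>' f) \<subseteq> XOR M R Pred Pblue"
    unfolding XOR_def
    by (intro subsetI CollectI bexI[OF _ assms(1)] bexI[OF _ assms(2)] conjI assms(3,4))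
  ultimately show ?thesis by (rule subset_antisym)
qed

end

end

theory Submission
  imports Defs
begin

text \<open>
  Write \<open>x e = exp (- 2 * J e)\<close>. Polygon configurations are the cycles modulo 2 of the graph; those
  of class zero are the boundaries of sets of faces in the primal graph, and in the dual graph they
  are the cuts of the primal graph by sets of vertices (\<open>boundaries_dual\<close>).

  In the low temperature expansion, \<open>Z_Ising\<close> with defect \<open>\<epsilon>\<close> is a sum over the cycles of class
  \<open>\<epsilon>\<close>, each arising from two opposite spin configurations. The XOR configuration of two such cycles
  is their symmetric difference (\<open>XOR_eq_sym_diff\<close>), and it is a boundary because the cycles are
  homologous. Conversely, if \<open>P\<close> is a boundary and \<open>A\<close> any cycle, then \<open>A\<close> and its symmetric
  difference with \<open>P\<close> are homologous. Summing over all classes thus removes the homology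
  constraint: the contribution of \<open>P\<close> is a sum over all cycles \<open>A\<close> (\<open>XOR_contribution_eq\<close>). An
  edge of \<open>P\<close> lies in exactly one cycle of the pair and contributes \<open>x e\<close> whatever \<open>A\<close> is; any other
  edge contributes \<open>(x e)\<^sup>2\<close> if it lies in \<open>A\<close>, and 1 otherwise. So one has to sum over all cycles
  \<open>A\<close> the product over \<open>A\<close> of a weight \<open>y\<close>, equal to 1 on \<open>P\<close> and to \<open>x\<^sup>2\<close> elsewhere.

  This sum is rewritten by Kramers--Wannier duality, in the form of the MacWilliams identity between
  the cycle space and its orthogonal, the cut space (\<open>cycle_sum_eq_cut_sum\<close>): up to a constant it is
  the sum over cuts \<open>Q\<close> of the product of \<open>1 - y e\<close> over the edges in \<open>Q\<close> and \<open>1 + y e\<close> over the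
  others. As \<open>y = 1\<close> on \<open>P\<close>, the cuts that meet \<open>P\<close> drop out, which is the condition of disjointness,
  and the remaining terms are the loop weights (\<open>sum_pair_weight\<close>). Euler's formula turns the
  powers of 2 into those of \<open>C_I\<close>.
\<close>

section \<open>Products of weights over subsets\<close>

text \<open>
  An element of \<open>P\<close> lies in exactly one of the two sets on the left, an element outside \<open>P\<close> in both
  or in none.
\<close>

lemma prod_sym_diff_weight:
  fixes w :: "'a \<Rightarrow> 'b :: comm_semiring_1"
  assumes fin: "finite A" "finite P"
  shows "prod w A * prod w (sym_diff A P) = prod w P * (\<Prod>e\<in>A. if e \<in> P then 1 else (w e)\<^sup>2)"
proof -
  have "prod w A = prod w (A \<inter> P) * prod w (A - P)"
    using fin by (subst prod.Int_Diff[of A _ P]) auto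
  moreover have "prod w P = prod w (A \<inter> P) * prod w (P - A)"
    using fin by (subst prod.Int_Diff[of P _ A]) (auto simp: Int_commute)
  moreover have "prod w (sym_diff A P) = prod w (A - P) * prod w (P - A)"
    using fin by (intro prod.union_disjoint) auto
  moreover have "(\<Prod>e\<in>A. if e \<in> P then 1 else (w e)\<^sup>2) = (\<Prod>e\<in>A - P. (w e)\<^sup>2)"
    using fin by (intro prod.mono_neutral_cong_right) auto
  ultimately show ?thesis by (simp add: power2_eq_square prod.distrib ac_simps)
qed

lemma prod_minus_one_card:
  assumes "finite A"
  shows "(\<Prod>x\<in>A. if Q x then -1 else 1) = ((-1) ^ card {x \<in> A. Q x} :: 'a :: comm_ring_1)"
  using assms by (simp add: prod.If_cases Int_def)

lemma prod_if_subset: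
  assumes "finite E" "P \<subseteq> E"
  shows "(\<Prod>e\<in>E. if e \<in> P then f e else 1) = prod f P"
  using assms by (intro prod.mono_neutral_cong_right) auto

section \<open>Cuts and their orthogonality to cycles\<close>

text \<open>
  As in the definition of \<open>face_boundary\<close>, the ends of an edge are counted with parity, so that a loop
  belongs to no cut and \<open>face_boundary\<close> becomes the cut operation of the dual graph.
\<close>

definition vertex_cut :: "('v, 'd) rotation_system \<Rightarrow> 'v set \<Rightarrow> 'd set set" where
  "vertex_cut M W = {e \<in> edges M. odd (card {a \<in> e. tail (skeleton M) a \<in> W})}"

definition cut_space :: "('v, 'd) rotation_system \<Rightarrow> 'd set set set" where
  "cut_space M = vertex_cut M ` Pow (vertices M)"

lemma boundaries_eq_cut_space_dual: "boundaries M = cut_space (dual M)"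
  by (simp add: boundaries_def cut_space_def face_boundary_def vertex_cut_def)

lemma face_boundary_eq_vertex_cut_dual: "face_boundary M W = vertex_cut (dual M) W"
  by (simp add: face_boundary_def vertex_cut_def)

context embedded_graph
begin

lemma edge_cases:
  assumes "e \<in> edges M"
  obtains a where "a \<in> darts M" "e = edge_of M a"
  using assms by (auto simp: edges_def)

lemma edge_of_eq: "b \<in> edge_of M a \<Longrightarrow> edge_of M b = edge_of M a"
  by (auto simp: edge_of_def)

lemma vertex_cut_iff:
  assumes "a \<in> darts M"
  shows "edge_of M a \<in> vertex_cut M W \<longleftrightarrow>
    (tail (skeleton M) a \<in> W) \<noteq> (head (skeleton M) a \<in> W)"
proof -
  have "{b \<in> edge_of M a. tail (skeleton M) b \<in> W} =
    (if tail (skeleton M) a \<in> W then {a} else {}) \<union>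
    (if head (skeleton M) a \<in> W then {opp M a} else {})"
    using assms by (auto simp: edge_of_def)
  then show ?thesis
    using assms arev_neq[of a] by (auto simp: vertex_cut_def edges_def)
qed

lemma vertex_cut_sym_diff:
  "sym_diff (vertex_cut M V) (vertex_cut M W) = vertex_cut M (sym_diff V W)"
proof (rule Set.set_eqI)
  fix e
  show "e \<in> sym_diff (vertex_cut M V) (vertex_cut M W) \<longleftrightarrow> e \<in> vertex_cut M (sym_diff V W)"
  proof (cases "e \<in> edges M")
    case True
    then show ?thesis by (elim edge_cases) (auto simp: vertex_cut_iff)
  qed (auto simp: vertex_cut_def)
qed

lemma vertices_nonempty: "vertices M \<noteq> {}"
  using strongly_connected_skeleton by (simp add: strongly_connected_def)

text \<open>
  A set of vertices with empty cut is closed under adjacency, hence trivial in a connected graph.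
\<close>

lemma vertex_cut_empty_iff:
  assumes "W \<subseteq> vertices M"
  shows "vertex_cut M W = {} \<longleftrightarrow> W = {} \<or> W = vertices M"
proof
  assume cut: "vertex_cut M W = {}"
  have adj: "x \<in> W \<longleftrightarrow> y \<in> W" if xy: "x \<rightarrow>\<^bsub>skeleton M\<^esub> y" for x y
  proof -
    obtain c where "c \<in> darts M" "tail (skeleton M) c = x" "head (skeleton M) c = y"
      using xy by (auto simp: arcs_ends_def arc_to_ends_def)
    then show ?thesis using cut vertex_cut_iff[of c W] by auto
  qed
  have "x \<in> W \<longleftrightarrow> y \<in> W" if "x \<rightarrow>\<^sup>*\<^bsub>skeleton M\<^esub> y" for x y
    using that by (induction rule: reachable_induct) (simp_all add: adj)
  then have "x \<in> W \<longleftrightarrow> y \<in> W" if "x \<in> vertices M" "y \<in> vertices M" for x y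
    using strongly_connected_skeleton that by (auto simp: strongly_connected_def)
  then show "W = {} \<or> W = vertices M" using assms by blast
next
  assume W: "W = {} \<or> W = vertices M"
  show "vertex_cut M W = {}"
  proof (rule equals0I)
    fix e assume e: "e \<in> vertex_cut M W"
    then have "e \<in> edges M" by (simp add: vertex_cut_def)
    then show False using e W by (elim edge_cases) (auto simp: vertex_cut_iff)
  qed
qed

lemma vertex_cut_eq_iff:
  assumes "V \<subseteq> vertices M" "W \<subseteq> vertices M"
  shows "vertex_cut M V = vertex_cut M W \<longleftrightarrow> V = W \<or> V = vertices M - W"
proof -
  have "vertex_cut M V = vertex_cut M W \<longleftrightarrow> vertex_cut M (sym_diff V W) = {}"
    unfolding vertex_cut_sym_diff[symmetric] by blast
  also have "\<dots> \<longleftrightarrow> sym_diff V W = {} \<or> sym_diff V W = vertices M"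
    using assms by (intro vertex_cut_empty_iff) blast
  finally show ?thesis using assms by blast
qed

text \<open>
  By connectedness a cut determines the set of vertices that defines it up to complementation, and a
  set differs from its complement because there is at least one vertex.
\<close>

lemma sum_vertex_cut:
  fixes f :: "'d set set \<Rightarrow> 'c :: comm_semiring_1"
  shows "(\<Sum>W\<in>Pow (vertices M). f (vertex_cut M W)) = 2 * (\<Sum>Q\<in>cut_space M. f Q)"
proof -
  have "card {W \<in> Pow (vertices M). vertex_cut M W = Q} = 2" if Q: "Q \<in> cut_space M" for Q
  proof -
    obtain V where V: "V \<subseteq> vertices M" "Q = vertex_cut M V" using Q by (auto simp: cut_space_def)
    have "{W \<in> Pow (vertices M). vertex_cut M W = Q} = {V, vertices M - V}"
      using V(1) vertex_cut_eq_iff[OF _ V(1)] unfolding V(2) by blast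
    moreover have "V \<noteq> vertices M - V" using V vertices_nonempty by blast
    ultimately show ?thesis by simp
  qed
  then show ?thesis
    unfolding sum_distrib_left
    by (subst sum_fun_comp[where R = "cut_space M"]) (auto simp: cut_space_def)
qed

lemma finite_cut_space [simp]: "finite (cut_space M)"
  by (simp add: cut_space_def)

lemma spin_product_vertex_cut:
  assumes "e \<in> edges M" "\<And>v. v \<in> vertices M \<Longrightarrow> \<sigma> v = (if v \<in> W then -1 else 1)"
  shows "spin_product M \<sigma> e = (if e \<in> vertex_cut M W then -1 else 1)"
proof -
  have fin: "finite e" and e: "e \<subseteq> darts M"
    using assms(1) by (auto simp: edges_def edge_of_def)
  have "spin_product M \<sigma> e = (\<Prod>a\<in>e. if tail (skeleton M) a \<in> W then -1 else 1)"
    unfolding spin_product_def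
  proof (intro prod.cong refl)
    fix a assume "a \<in> e"
    then have "tail (skeleton M) a \<in> vertices M" using e by auto
    then show "\<sigma> (tail (skeleton M) a) = (if tail (skeleton M) a \<in> W then -1 else 1)"
      by (rule assms(2))
  qed
  also have "\<dots> = (-1) ^ card {a \<in> e. tail (skeleton M) a \<in> W}"
    using fin by (rule prod_minus_one_card)
  finally show ?thesis using assms(1) by (auto simp: vertex_cut_def)
qed

text \<open>
  The orthogonality pairing between edge sets and cuts, computed dart by dart: giving sign \<open>-1\<close> to the
  vertices in \<open>W\<close>, every dart of an edge of \<open>R\<close> contributes the sign of its tail, and the darts can be
  collected either by edges or by tails.
\<close>

lemma prod_cut_sign:
  assumes R: "R \<subseteq> edges M" and W: "W \<subseteq> vertices M"
  shows "(\<Prod>e\<in>R. if e \<in> vertex_cut M W then -1 else 1 :: real) =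
    (\<Prod>v\<in>W. (-1) ^ card {a \<in> out_arcs (skeleton M) v. edge_of M a \<in> R})"
proof -
  let ?\<sigma> = "\<lambda>v. if v \<in> W then -1 else 1 :: real"
  have dartsR: "\<Union>R = {a \<in> darts M. edge_of M a \<in> R}"
  proof (intro subset_antisym subsetI)
    fix a assume "a \<in> \<Union>R"
    then obtain e b where "e \<in> R" "a \<in> e" "b \<in> darts M" "e = edge_of M b"
      using R by (meson UnionE edge_cases subsetD)
    then show "a \<in> {a \<in> darts M. edge_of M a \<in> R}"
      using edge_of_eq[of a b] by (auto simp: edge_of_def)
  qed (auto simp: edge_of_def)
  have "(\<Prod>e\<in>R. if e \<in> vertex_cut M W then -1 else 1 :: real) = (\<Prod>e\<in>R. spin_product M ?\<sigma> e)"
    using R by (intro prod.cong refl spin_product_vertex_cut[symmetric]) auto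
  also have "\<dots> = (\<Prod>a\<in>\<Union>R. ?\<sigma> (tail (skeleton M) a))"
    unfolding spin_product_def
  proof (subst prod.Union_disjoint)
    show "\<forall>e\<in>R. finite e" using R by (auto simp: edges_def edge_of_def)
    show "\<forall>e\<in>R. \<forall>e'\<in>R. e \<noteq> e' \<longrightarrow> e \<inter> e' = {}"
    proof (intro ballI impI)
      fix e e' assume "e \<in> R" "e' \<in> R" "e \<noteq> e'"
      moreover from this obtain a b where "e = edge_of M a" "e' = edge_of M b"
        using R by (meson edge_cases subsetD)
      ultimately show "e \<inter> e' = {}" using edge_of_eq by blast
    qed
  qed auto
  also have "\<dots> = (-1) ^ card {a \<in> \<Union>R. tail (skeleton M) a \<in> W}"
    unfolding dartsR by (rule prod_minus_one_card) simp
  also have "{a \<in> \<Union>R. tail (skeleton M) a \<in> W} =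
      (\<Union>v\<in>W. {a \<in> out_arcs (skeleton M) v. edge_of M a \<in> R})"
    unfolding dartsR by auto
  also have "card \<dots> = (\<Sum>v\<in>W. card {a \<in> out_arcs (skeleton M) v. edge_of M a \<in> R})"
    using finite_subset[OF W] by (intro card_UN_disjoint) auto
  finally show ?thesis by (simp add: power_sum)
qed

text \<open>
  Fourier inversion over sets of vertices: the sum factorizes over the vertices, and the factor of a
  vertex is 2 or 0 according to the parity of its degree in \<open>R\<close>.
\<close>

lemma sum_prod_cut_sign:
  assumes "R \<subseteq> edges M"
  shows "(\<Sum>W\<in>Pow (vertices M). \<Prod>e\<in>R. if e \<in> vertex_cut M W then -1 else 1 :: real) =
    (if polygon_config M R then 2 ^ card (vertices M) else 0)"
proof -
  let ?c = "\<lambda>v. (-1) ^ card {a \<in> out_arcs (skeleton M) v. edge_of M a \<in> R} :: real"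
  have "(\<Sum>W\<in>Pow (vertices M). \<Prod>e\<in>R. if e \<in> vertex_cut M W then -1 else 1 :: real) =
      (\<Sum>W\<in>Pow (vertices M). prod ?c W * (\<Prod>v\<in>vertices M - W. 1))"
    using assms by (intro sum.cong) (auto simp: prod_cut_sign)
  also have "\<dots> = (\<Prod>v\<in>vertices M. ?c v + 1)" by (rule prod_add[symmetric]) simp
  also have "\<dots> = (if polygon_config M R then 2 ^ card (vertices M) else 0)"
  proof (cases "polygon_config M R")
    case True
    then have "(\<Prod>v\<in>vertices M. ?c v + 1) = (\<Prod>v\<in>vertices M. 2)"
      by (intro prod.cong) (auto simp: polygon_config_def)
    then show ?thesis using True by simp
  next
    case False
    then obtain v where "v \<in> vertices M" "?c v + 1 = 0"
      using assms by (auto simp: polygon_config_def)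
    then have "(\<Prod>v\<in>vertices M. ?c v + 1) = 0" by (intro prod_zero) auto
    then show ?thesis using False by simp
  qed
  finally show ?thesis .
qed

text \<open>
  The MacWilliams identity for the cycle space. Expanding the product on the right over subsets \<open>R\<close>
  of edges, with the cut given by a set of vertices, and summing over these sets of vertices first
  leaves only the polygon configurations \<open>R\<close>. The factor 2 on the right is the number of sets of
  vertices that define a given cut. Physically this is the high temperature expansion.
\<close>

lemma cycle_sum_eq_cut_sum:
  fixes y :: "'d set \<Rightarrow> real"
  shows "2 ^ card (vertices M) * (\<Sum>R | polygon_config M R. prod y R) =
    2 * (\<Sum>Q\<in>cut_space M. (\<Prod>e\<in>edges M. 1 + (if e \<in> Q then - y e else y e)))"
proof -
  let ?s = "\<lambda>W e. if e \<in> vertex_cut M W then -1 else 1 :: real"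
  have "2 * (\<Sum>Q\<in>cut_space M. \<Prod>e\<in>edges M. 1 + (if e \<in> Q then - y e else y e)) =
      (\<Sum>W\<in>Pow (vertices M). \<Prod>e\<in>edges M. 1 + (if e \<in> vertex_cut M W then - y e else y e))"
    by (rule sum_vertex_cut[symmetric])
  also have "\<dots> = (\<Sum>W\<in>Pow (vertices M). \<Sum>R\<in>Pow (edges M). prod y R * prod (?s W) R)"
  proof (intro sum.cong refl)
    fix W
    have "(\<Prod>e\<in>edges M. 1 + (if e \<in> vertex_cut M W then - y e else y e)) =
        (\<Prod>e\<in>edges M. y e * ?s W e + 1)"
      by (intro prod.cong) auto
    also have "\<dots> = (\<Sum>R\<in>Pow (edges M). (\<Prod>e\<in>R. y e * ?s W e) * (\<Prod>e\<in>edges M - R. 1))"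
      by (rule prod_add) simp
    finally show "(\<Prod>e\<in>edges M. 1 + (if e \<in> vertex_cut M W then - y e else y e)) =
        (\<Sum>R\<in>Pow (edges M). prod y R * prod (?s W) R)"
      by (simp add: prod.distrib)
  qed
  also have "\<dots> = (\<Sum>R\<in>Pow (edges M). prod y R * (\<Sum>W\<in>Pow (vertices M). prod (?s W) R))"
    by (subst sum.swap) (simp add: sum_distrib_left)
  also have "\<dots> = (\<Sum>R\<in>Pow (edges M).
      if polygon_config M R then 2 ^ card (vertices M) * prod y R else 0)"
    by (intro sum.cong) (auto simp: sum_prod_cut_sign)
  also have "\<dots> = (\<Sum>R | polygon_config M R. 2 ^ card (vertices M) * prod y R)"
    by (intro sum.mono_neutral_cong_right) (auto simp: polygon_config_def)
  finally show ?thesis by (simp add: sum_distrib_left)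
qed


section \<open>Homology\<close>

lemma finite_cycles [simp]: "finite {P. polygon_config M P}"
  by (rule finite_subset[of _ "Pow (edges M)"]) (auto simp: polygon_config_def)

lemma polygon_config_boundary: "B \<in> boundaries M \<Longrightarrow> polygon_config M B"
  by (auto simp: boundaries_def polygon_config_face_boundary)

lemma finite_boundaries: "finite (boundaries M)"
  using finite_cycles by (rule finite_subset[rotated]) (auto simp: polygon_config_boundary)

lemma boundaries_coset: "boundaries M #>\<^bsub>cycle_group M\<^esub> P = (\<lambda>B. sym_diff P B) ` boundaries M"
  by (auto simp: r_coset_def cycle_group_def Un_commute)

text \<open>
  The homology class of a cycle is a coset, so a homology class is itself the set of polygon
  configurations with that class.
\<close>

lemma polygons_eq_class:
  assumes "\<epsilon> \<in> carrier (H1 M)"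
  shows "polygons M \<epsilon> = \<epsilon>"
proof -
  interpret Z: comm_group "cycle_group M" by (rule comm_group_cycle_group)
  have sub: "subgroup (boundaries M) (cycle_group M)"
    using normal_boundaries by (rule normal_imp_subgroup)
  obtain Q where Q: "Q \<in> carrier (cycle_group M)" "\<epsilon> = homology_class M Q"
    using assms by (auto simp: H1_def FactGroup_def RCOSETS_def homology_class_def)
  show ?thesis
  proof
    show "polygons M \<epsilon> \<subseteq> \<epsilon>"
      using Z.rcos_self[OF _ sub] by (auto simp: polygons_def homology_class_def cycle_group_def)
    show "\<epsilon> \<subseteq> polygons M \<epsilon>"
    proof
      fix P assume P: "P \<in> \<epsilon>"
      then have "P \<in> carrier (cycle_group M)"
        using subgroup.elemrcos_carrier[OF sub Z.group_axioms Q(1)] Q(2)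
        by (simp add: homology_class_def)
      moreover have "homology_class M P = \<epsilon>"
        using Z.repr_independence[OF _ Q(1) sub] P Q(2) by (simp add: homology_class_def)
      ultimately show "P \<in> polygons M \<epsilon>" by (simp add: polygons_def cycle_group_def)
    qed
  qed
qed

lemma polygons_zero: "polygons M \<one>\<^bsub>H1 M\<^esub> = boundaries M"
proof -
  interpret normal "boundaries M" "cycle_group M" by (rule normal_boundaries)
  interpret H: group "H1 M" unfolding H1_def by (rule factorgroup_is_group)
  have "polygons M \<one>\<^bsub>H1 M\<^esub> = \<one>\<^bsub>H1 M\<^esub>" by (rule polygons_eq_class) simp
  then show ?thesis by (simp add: H1_def FactGroup_def)
qed

lemma polygons_eq_translate:
  assumes "\<epsilon> \<in> carrier (H1 M)" "R \<in> polygons M \<epsilon>"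
  shows "polygons M \<epsilon> = (\<lambda>B. sym_diff R B) ` boundaries M"
  using assms polygons_eq_class[of \<epsilon>]
  by (simp add: polygons_def homology_class_def boundaries_coset)

lemma sum_polygons:
  assumes "\<epsilon> \<in> carrier (H1 M)" "R \<in> polygons M \<epsilon>"
  shows "(\<Sum>P\<in>polygons M \<epsilon>. f P) = (\<Sum>B\<in>boundaries M. f (sym_diff R B))"
proof -
  have "inj_on (\<lambda>B. sym_diff R B) (boundaries M)" by (rule inj_onI) blast
  then show ?thesis unfolding polygons_eq_translate[OF assms] by (simp add: sum.reindex)
qed

lemma sum_homology_classes:
  fixes f :: "'d set set \<Rightarrow> 'c :: comm_monoid_add"
  shows "(\<Sum>\<epsilon>\<in>carrier (H1 M). \<Sum>P\<in>polygons M \<epsilon>. f P) = (\<Sum>P | polygon_config M P. f P)"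
proof -
  interpret Z: comm_group "cycle_group M" by (rule comm_group_cycle_group)
  have sub: "subgroup (boundaries M) (cycle_group M)"
    using normal_boundaries by (rule normal_imp_subgroup)
  have H1: "carrier (H1 M) = rcosets\<^bsub>cycle_group M\<^esub> boundaries M"
    by (simp add: H1_def FactGroup_def)
  have U: "\<Union>(carrier (H1 M)) = {P. polygon_config M P}"
    unfolding H1 Z.rcosets_part_G[OF sub] by (simp add: cycle_group_def)
  have "(\<Sum>\<epsilon>\<in>carrier (H1 M). \<Sum>P\<in>polygons M \<epsilon>. f P) = (\<Sum>\<epsilon>\<in>carrier (H1 M). sum f \<epsilon>)"
    by (intro sum.cong) (auto simp: polygons_eq_class)
  also have "\<dots> = sum f (\<Union>(carrier (H1 M)))"
  proof (subst sum.Union_disjoint)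
    show "\<forall>A\<in>carrier (H1 M). finite A"
      using finite_cycles unfolding U[symmetric] by (meson Union_upper finite_subset)
    show "\<forall>A\<in>carrier (H1 M). \<forall>B\<in>carrier (H1 M). A \<noteq> B \<longrightarrow> A \<inter> B = {}"
      using Z.rcos_disjoint[OF sub] unfolding H1 by (auto simp: pairwise_def disjnt_def)
  qed auto
  finally show ?thesis by (simp add: U)
qed

text \<open>
  The faces of the dual graph are the orbits of \<open>rot M\<close>, that is, the sets of darts leaving a vertex.
  Sets of faces of the dual graph and sets of vertices are compared only through the darts they
  select, so that the graph with a single vertex and no edge needs no separate treatment.
\<close>

lemma boundaries_dual: "boundaries (dual M) = cut_space M"
proof -
  let ?F = "face_of (dual M)" and ?t = "tail (skeleton M)"
  interpret D: embedded_graph "dual M" by (rule embedded_graph_dual)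
  have F: "?F a = ?F b \<longleftrightarrow> ?t a = ?t b" if "a \<in> darts M" "b \<in> darts M" for a b
  proof -
    have rot: "face_succ (dual M) = rot M"
      by (auto simp: face_succ_def fun_eq_iff)
    have "?F a = out_arcs (skeleton M) (?t a)" if a: "a \<in> darts M" for a
    proof -
      have "cyclic_on (rot M) (out_arcs (skeleton M) (?t a))"
        using a by (intro rot_cyclic) auto
      then show ?thesis
        using a unfolding face_of_def rot by (simp add: cyclic_on_alldef)
    qed
    then show ?thesis using that by auto
  qed
  have *: "face_boundary (dual M) U = vertex_cut M W"
    if "\<And>a. a \<in> darts M \<Longrightarrow> ?F a \<in> U \<longleftrightarrow> ?t a \<in> W" for U W
  proof -
    have "{a \<in> e. ?F a \<in> U} = {a \<in> e. ?t a \<in> W}" if "e \<in> edges M" for e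
      using that \<open>\<And>a. a \<in> darts M \<Longrightarrow> ?F a \<in> U \<longleftrightarrow> ?t a \<in> W\<close>
      by (auto simp: edges_def edge_of_def)
    then show ?thesis by (auto simp: face_boundary_def vertex_cut_def)
  qed
  show ?thesis
  proof (intro subset_antisym subsetI)
    fix Q assume "Q \<in> boundaries (dual M)"
    then obtain U where "Q = face_boundary (dual M) U" by (auto simp: boundaries_def)
    also have "\<dots> = vertex_cut M (?t ` {a \<in> darts M. ?F a \<in> U})"
      by (rule *) (use F in \<open>auto simp: image_iff; metis\<close>)
    finally show "Q \<in> cut_space M" by (auto simp: cut_space_def)
  next
    fix Q assume "Q \<in> cut_space M"
    then obtain W where "Q = vertex_cut M W" by (auto simp: cut_space_def)
    also have "\<dots> = face_boundary (dual M) (?F ` {a \<in> darts M. ?t a \<in> W})"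
      by (rule *[symmetric]) (use F in \<open>auto simp: image_iff; metis\<close>)
    finally show "Q \<in> boundaries (dual M)"
      by (auto simp: boundaries_def intro!: D.face_of_in_faces)
  qed
qed

end

section \<open>Low temperature expansion\<close>

text \<open>
  The spin configuration on \<open>V\<close> that equals \<open>-1\<close> exactly on \<open>W\<close>; \<open>spins\<close> consists of functions
  that are undefined outside the vertices, whence the restriction.
\<close>

definition spin_config :: "'v set \<Rightarrow> 'v set \<Rightarrow> 'v \<Rightarrow> real" where
  "spin_config V W = (\<lambda>v\<in>V. if v \<in> W then -1 else 1)"

lemma bij_spin_config: "bij_betw (spin_config (vertices N)) (Pow (vertices N)) (spins N)"
proof (rule bij_betw_byWitness[where f' = "\<lambda>\<sigma>. {v \<in> vertices N. \<sigma> v = -1}"])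
  show "\<forall>\<sigma>\<in>spins N. spin_config (vertices N) {v \<in> vertices N. \<sigma> v = -1} = \<sigma>"
    by (auto simp: spin_config_def spins_def fun_eq_iff PiE_def Pi_def extensional_def restrict_def)
qed (auto simp: spins_def spin_config_def)

context embedded_graph
begin

lemma spin_product_spin_config:
  assumes "e \<in> edges M"
  shows "spin_product (dual M) (spin_config (faces M) W) e =
    (if e \<in> face_boundary M W then -1 else 1)"
proof -
  interpret D: embedded_graph "dual M" by (rule embedded_graph_dual)
  show ?thesis unfolding face_boundary_eq_vertex_cut_dual
    by (rule D.spin_product_vertex_cut) (use assms in \<open>auto simp: spin_config_def\<close>)
qed

lemma polygon_of_spin_config:
  assumes "R \<subseteq> edges M"
  shows "polygon_of_spin M R (spin_config (faces M) W) = sym_diff R (face_boundary M W)"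
  using assms
  by (auto simp: polygon_of_spin_def spin_product_spin_config defect_sign_def face_boundary_def
      split: if_splits)

lemma sum_face_boundary:
  fixes f :: "'d set set \<Rightarrow> 'c :: comm_semiring_1"
  shows "(\<Sum>W\<in>Pow (faces M). f (face_boundary M W)) = 2 * (\<Sum>B\<in>boundaries M. f B)"
proof -
  interpret D: embedded_graph "dual M" by (rule embedded_graph_dual)
  show ?thesis
    using D.sum_vertex_cut[of f]
    by (simp add: face_boundary_eq_vertex_cut_dual boundaries_eq_cut_space_dual)
qed

text \<open>
  Every edge contributes \<open>exp (J e)\<close>, with an additional factor \<open>exp (- 2 * J e)\<close> on the polygon
  configuration of the spins. As the set \<open>W\<close> of faces with spin \<open>-1\<close> varies, this configuration
  runs through the translates of the defect \<open>R\<close> by boundaries, that is, through the class \<open>\<epsilon>\<close>, and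
  each one is obtained twice.
\<close>

lemma Z_Ising_polygons:
  assumes \<epsilon>: "\<epsilon> \<in> carrier (H1 M)" and R: "R \<in> polygons M \<epsilon>"
  shows "Z_Ising M J R =
    2 * (\<Prod>e\<in>edges M. exp (J e)) * (\<Sum>P\<in>polygons M \<epsilon>. \<Prod>e\<in>P. exp (- 2 * J e))"
proof -
  have RE: "R \<subseteq> edges M" using R by (simp add: polygons_def polygon_config_def)
  have weight: "exp (\<Sum>e\<in>edges M.
        defect_sign R e * J e * spin_product (dual M) (spin_config (faces M) W) e) =
      (\<Prod>e\<in>edges M. exp (J e)) * (\<Prod>e\<in>sym_diff R (face_boundary M W). exp (- 2 * J e))" for W
  proof -
    let ?P = "sym_diff R (face_boundary M W)"
    have "?P \<subseteq> edges M" using RE by (auto simp: face_boundary_def)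
    then have "(\<Prod>e\<in>?P. exp (- 2 * J e)) = (\<Prod>e\<in>edges M. if e \<in> ?P then exp (- 2 * J e) else 1)"
      by (rule prod_if_subset[symmetric, rotated]) simp
    moreover have "exp (defect_sign R e * J e * spin_product (dual M) (spin_config (faces M) W) e) =
        exp (J e) * (if e \<in> ?P then exp (- 2 * J e) else 1)" if "e \<in> edges M" for e
      using that by (auto simp: spin_product_spin_config defect_sign_def exp_add[symmetric])
    ultimately show ?thesis by (simp add: exp_sum prod.distrib)
  qed
  have "Z_Ising M J R = (\<Sum>W\<in>Pow (faces M). exp (\<Sum>e\<in>edges M.
      defect_sign R e * J e * spin_product (dual M) (spin_config (faces M) W) e))"
    unfolding Z_Ising_def using bij_spin_config[of "dual M"]
    by (subst sum.reindex_bij_betw[symmetric]) auto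
  also have "\<dots> = 2 * (\<Sum>B\<in>boundaries M.
      (\<Prod>e\<in>edges M. exp (J e)) * (\<Prod>e\<in>sym_diff R B. exp (- 2 * J e)))"
    unfolding weight by (rule sum_face_boundary)
  finally show ?thesis by (simp add: sum_polygons[OF \<epsilon> R] sum_distrib_left mult.assoc)
qed

text \<open>
  Two cycles with the homology class of the defect differ from it by boundaries of sets of faces, so
  both are realized by spin configurations; multiplying these cancels the defect.
\<close>

lemma XOR_eq_sym_diff:
  assumes \<epsilon>: "\<epsilon> \<in> carrier (H1 M)" and R: "R \<in> polygons M \<epsilon>"
    and P: "P \<in> polygons M \<epsilon>" and P': "P' \<in> polygons M \<epsilon>"
  shows "XOR M R P P' = sym_diff P P'"
proof -
  have RE: "R \<subseteq> edges M" using R by (simp add: polygons_def polygon_config_def)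
  have "\<exists>\<sigma>\<in>spins (dual M). polygon_of_spin M R \<sigma> = A" if A: "A \<in> polygons M \<epsilon>" for A
  proof -
    obtain W where W: "W \<subseteq> faces M" "A = sym_diff R (face_boundary M W)"
      using A unfolding polygons_eq_translate[OF \<epsilon> R] by (auto simp: boundaries_def)
    moreover have "spin_config (faces M) W \<in> spins (dual M)"
      by (auto simp: spins_def spin_config_def)
    ultimately show ?thesis using polygon_of_spin_config[OF RE] by blast
  qed
  then obtain \<sigma> \<sigma>' where \<sigma>: "\<sigma> \<in> spins (dual M)" "\<sigma>' \<in> spins (dual M)"
    "polygon_of_spin M R \<sigma> = P" "polygon_of_spin M R \<sigma>' = P'"
    using P P' by meson
  show ?thesis
    using XOR_eqI[OF \<sigma>] interface_mult[OF \<sigma>(1,2), of R] \<sigma>(3,4) by simp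
qed

section \<open>Pairs of polygon configurations with a given XOR\<close>

definition pair_weight :: "('d set \<Rightarrow> real) \<Rightarrow> 'd set set \<Rightarrow> 'd set set \<Rightarrow> real" where
  "pair_weight J A B =
    (2 * (\<Prod>e\<in>edges M. exp (J e)))\<^sup>2 * (\<Prod>e\<in>A. exp (- 2 * J e)) * (\<Prod>e\<in>B. exp (- 2 * J e))"

text \<open>
  For a boundary \<open>P\<close>, a cycle \<open>A\<close> has a unique partner with XOR configuration \<open>P\<close>, and this partner
  lies in the homology class of \<open>A\<close>. Hence \<open>A\<close> runs freely through all cycles as \<open>\<epsilon>\<close> varies.
\<close>

lemma XOR_contribution_eq:
  assumes rep: "\<And>\<epsilon>. \<epsilon> \<in> carrier (H1 M) \<Longrightarrow> rep \<epsilon> \<in> polygons M \<epsilon>"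
    and P: "P \<in> boundaries M"
  shows "XOR_contribution M J rep P = (\<Sum>A | polygon_config M A. pair_weight J A (sym_diff A P))"
proof -
  have "(\<Sum>(A, A') \<in> {(A, A') \<in> polygons M \<epsilon> \<times> polygons M \<epsilon>. XOR M (rep \<epsilon>) A A' = P}.
      pair_weight J A A') = (\<Sum>A\<in>polygons M \<epsilon>. pair_weight J A (sym_diff A P))"
    if \<epsilon>: "\<epsilon> \<in> carrier (H1 M)" for \<epsilon>
  proof -
    have "{(A, A') \<in> polygons M \<epsilon> \<times> polygons M \<epsilon>. XOR M (rep \<epsilon>) A A' = P} =
        (\<lambda>A. (A, sym_diff A P)) ` polygons M \<epsilon>" (is "?L = ?R")
    proof (intro subset_antisym subsetI)
      fix p assume "p \<in> ?L"
      then obtain A A' where A: "p = (A, A')" "A \<in> polygons M \<epsilon>" "sym_diff A A' = P"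
        using XOR_eq_sym_diff[OF \<epsilon> rep[OF \<epsilon>]] by auto
      then have "A' = sym_diff A P" by blast
      then show "p \<in> ?R" using A by blast
    next
      fix p assume "p \<in> ?R"
      then obtain A where A: "p = (A, sym_diff A P)" "A \<in> polygons M \<epsilon>" by blast
      have A': "sym_diff A P \<in> polygons M \<epsilon>"
        unfolding polygons_eq_translate[OF \<epsilon> A(2)] using P by (rule imageI)
      have "XOR M (rep \<epsilon>) A (sym_diff A P) = sym_diff A (sym_diff A P)"
        by (rule XOR_eq_sym_diff[OF \<epsilon> rep[OF \<epsilon>] A(2) A'])
      also have "\<dots> = P" by blast
      finally show "p \<in> ?L" using A A' by simp
    qed
    then show ?thesis by (simp add: sum.reindex inj_on_def)
  qed
  then have "XOR_contribution M J rep P =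
      (\<Sum>\<epsilon>\<in>carrier (H1 M). \<Sum>A\<in>polygons M \<epsilon>. pair_weight J A (sym_diff A P))"
    unfolding XOR_contribution_def pair_weight_def by (intro sum.cong) auto
  then show ?thesis by (simp only: sum_homology_classes)
qed

text \<open>
  The XOR configuration of two homologous cycles is a boundary, so only boundaries contribute.
\<close>

lemma Z_dIsing_eq_sum_XOR:
  assumes rep: "\<And>\<epsilon>. \<epsilon> \<in> carrier (H1 M) \<Longrightarrow> rep \<epsilon> \<in> polygons M \<epsilon>"
  shows "Z_dIsing M J rep = (\<Sum>P\<in>boundaries M. XOR_contribution M J rep P)"
proof -
  have "(Z_Ising M J (rep \<epsilon>))\<^sup>2 =
      (\<Sum>A\<in>polygons M \<epsilon>. \<Sum>P\<in>boundaries M. pair_weight J A (sym_diff A P))"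
    if \<epsilon>: "\<epsilon> \<in> carrier (H1 M)" for \<epsilon>
  proof -
    have "(Z_Ising M J (rep \<epsilon>))\<^sup>2 =
        (\<Sum>A\<in>polygons M \<epsilon>. \<Sum>A'\<in>polygons M \<epsilon>. pair_weight J A A')"
      unfolding Z_Ising_polygons[OF \<epsilon> rep[OF \<epsilon>]] pair_weight_def mult.assoc
        sum_distrib_left[symmetric] sum_distrib_right[symmetric]
      by (simp add: power2_eq_square ac_simps)
    also have "\<dots> = (\<Sum>A\<in>polygons M \<epsilon>. \<Sum>P\<in>boundaries M. pair_weight J A (sym_diff A P))"
      by (intro sum.cong refl sum_polygons[OF \<epsilon>])
    finally show ?thesis .
  qed
  then have "Z_dIsing M J rep =
      (\<Sum>\<epsilon>\<in>carrier (H1 M). \<Sum>A\<in>polygons M \<epsilon>. \<Sum>P\<in>boundaries M. pair_weight J A (sym_diff A P))"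
    by (simp add: Z_dIsing_def)
  also have "\<dots> = (\<Sum>A | polygon_config M A. \<Sum>P\<in>boundaries M. pair_weight J A (sym_diff A P))"
    by (rule sum_homology_classes)
  also have "\<dots> = (\<Sum>P\<in>boundaries M. \<Sum>A | polygon_config M A. pair_weight J A (sym_diff A P))"
    by (rule sum.swap)
  also have "\<dots> = (\<Sum>P\<in>boundaries M. XOR_contribution M J rep P)"
    by (intro sum.cong refl) (simp add: XOR_contribution_eq[OF rep])
  finally show ?thesis .
qed

section \<open>Kramers--Wannier duality for a fixed XOR configuration\<close>

lemma euler_card:
  assumes "has_genus M g"
  shows "card (faces M) + 2 * g + card (vertices M) = card (edges M) + 2"
  using assms by (simp add: has_genus_def euler_characteristic_def)

text \<open>
  Edge by edge, \<open>exp (2 * J e) * (1 + exp (- 4 * J e)) = 2 * cosh (2 * J e)\<close>. The number of edges in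
  the exponent of 2 is then eliminated by Euler's formula.
\<close>

lemma C_I_constant:
  assumes "has_genus M g"
  shows "(2 * (\<Prod>e\<in>edges M. exp (J e)))\<^sup>2 * (2 * (\<Prod>e\<in>edges M. 1 + exp (- 4 * J e))) =
    2 ^ card (vertices M) * C_I M g J"
proof -
  have "(\<Prod>e\<in>edges M. exp (J e))\<^sup>2 * (\<Prod>e\<in>edges M. 1 + exp (- 4 * J e)) =
      (\<Prod>e\<in>edges M. (exp (J e))\<^sup>2 * (1 + exp (- 4 * J e)))"
    by (simp add: prod.distrib prod_power_distrib)
  also have "\<dots> = (\<Prod>e\<in>edges M. 2 * cosh (2 * J e))"
    by (intro prod.cong refl)
      (simp add: cosh_field_def power2_eq_square exp_add[symmetric] distrib_left)
  also have "\<dots> = 2 ^ card (edges M) * (\<Prod>e\<in>edges M. cosh (2 * J e))"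
    by (simp add: prod.distrib)
  finally have "(2 * (\<Prod>e\<in>edges M. exp (J e)))\<^sup>2 * (2 * (\<Prod>e\<in>edges M. 1 + exp (- 4 * J e))) =
      2 ^ (card (edges M) + 3) * (\<Prod>e\<in>edges M. cosh (2 * J e))"
    by (simp add: power_mult_distrib power_add)
  also have "card (edges M) + 3 = card (vertices M) + (card (faces M) + 2 * g + 1)"
    using euler_card[OF assms] by simp
  finally show ?thesis by (simp add: C_I_def power_add mult.assoc)
qed

text \<open>
  An edge common to \<open>P\<close> and \<open>Q\<close> has \<open>y e = 1\<close> and gives the factor \<open>1 - y e = 0\<close>. For disjoint
  \<open>P\<close> and \<open>Q\<close> the factor \<open>1 + (x e)\<^sup>2\<close> is extracted from every edge; the corrections on \<open>P\<close> and
  \<open>Q\<close> are the two families of loop weights, up to the factor \<open>x e\<close> on \<open>P\<close>.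
\<close>

lemma prod_cut_factors:
  fixes x :: "'d set \<Rightarrow> real"
  assumes P: "P \<subseteq> edges M" and Q: "Q \<subseteq> edges M"
  defines "y \<equiv> \<lambda>e. if e \<in> P then 1 else (x e)\<^sup>2"
  shows "(\<Prod>e\<in>edges M. 1 + (if e \<in> Q then - y e else y e)) =
    (if P \<inter> Q = {} then (\<Prod>e\<in>edges M. 1 + (x e)\<^sup>2) *
       (\<Prod>e\<in>P. 2 / (1 + (x e)\<^sup>2)) * (\<Prod>e\<in>Q. (1 - (x e)\<^sup>2) / (1 + (x e)\<^sup>2)) else 0)"
proof (cases "P \<inter> Q = {}")
  case True
  have cancel: "(1 + (x e)\<^sup>2) * (t / (1 + (x e)\<^sup>2)) = t" for e t
    by (simp add: add_nonneg_eq_0_iff)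
  have "(\<Prod>e\<in>edges M. 1 + (if e \<in> Q then - y e else y e)) =
      (\<Prod>e\<in>edges M. (1 + (x e)\<^sup>2) * (if e \<in> P then 2 / (1 + (x e)\<^sup>2) else 1) *
        (if e \<in> Q then (1 - (x e)\<^sup>2) / (1 + (x e)\<^sup>2) else 1))"
    using True by (intro prod.cong) (auto simp: y_def cancel simp del: times_divide_eq_right)
  then show ?thesis using True P Q by (simp add: prod.distrib prod_if_subset)
next
  case False
  then obtain e where "e \<in> P" "e \<in> Q" by blast
  then have "(\<Prod>e\<in>edges M. 1 + (if e \<in> Q then - y e else y e)) = 0"
    using Q by (intro prod_zero) (auto simp: y_def)
  then show ?thesis using False by simp
qed

text \<open>
  Duality is applied to the weight \<open>y\<close> that remains after extracting the factor \<open>x e\<close> from every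
  edge of \<open>P\<close>; that factor completes the loop weight of \<open>P\<close>.
\<close>

lemma sum_pair_weight:
  assumes genus: "has_genus M g" and P: "P \<subseteq> edges M"
  shows "(\<Sum>A | polygon_config M A. pair_weight J A (sym_diff A P)) =
    (\<Sum>Q | Q \<in> cut_space M \<and> P \<inter> Q = {}. C_I M g J * loop_weight J P Q)"
proof -
  define x where "x = (\<lambda>e. exp (- 2 * J e))"
  define y where "y = (\<lambda>e. if e \<in> P then 1 else (x e)\<^sup>2)"
  define c where "c = (2 * (\<Prod>e\<in>edges M. exp (J e)))\<^sup>2"
  have x2: "(x e)\<^sup>2 = exp (- 4 * J e)" for e
    by (simp add: x_def power2_eq_square exp_add[symmetric])
  \<comment> \<open>The power of 2 is the normalization of the duality identity; it cancels at the end.\<close>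
  have "2 ^ card (vertices M) * (\<Sum>A | polygon_config M A. pair_weight J A (sym_diff A P)) =
      c * prod x P * (2 ^ card (vertices M) * (\<Sum>A | polygon_config M A. prod y A))"
  proof -
    have "pair_weight J A (sym_diff A P) = c * prod x P * prod y A" if "polygon_config M A" for A
      using that prod_sym_diff_weight[of A P x] P finite_subset[OF _ finite_edges]
      by (simp add: pair_weight_def polygon_config_def c_def x_def y_def mult.assoc)
    then show ?thesis by (simp add: sum_distrib_left[symmetric])
  qed
  also have "\<dots> = c * prod x P *
      (2 * (\<Sum>Q\<in>cut_space M. \<Prod>e\<in>edges M. 1 + (if e \<in> Q then - y e else y e)))"
    by (simp only: cycle_sum_eq_cut_sum)
  also have "(\<Sum>Q\<in>cut_space M. \<Prod>e\<in>edges M. 1 + (if e \<in> Q then - y e else y e)) =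
      (\<Sum>Q\<in>cut_space M. if P \<inter> Q = {} then (\<Prod>e\<in>edges M. 1 + (x e)\<^sup>2) *
        (\<Prod>e\<in>P. 2 / (1 + (x e)\<^sup>2)) * (\<Prod>e\<in>Q. (1 - (x e)\<^sup>2) / (1 + (x e)\<^sup>2)) else 0)"
  proof (intro sum.cong refl)
    fix Q assume "Q \<in> cut_space M"
    then have "Q \<subseteq> edges M" by (auto simp: cut_space_def vertex_cut_def)
    then show "(\<Prod>e\<in>edges M. 1 + (if e \<in> Q then - y e else y e)) =
        (if P \<inter> Q = {} then (\<Prod>e\<in>edges M. 1 + (x e)\<^sup>2) *
        (\<Prod>e\<in>P. 2 / (1 + (x e)\<^sup>2)) * (\<Prod>e\<in>Q. (1 - (x e)\<^sup>2) / (1 + (x e)\<^sup>2)) else 0)"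
      unfolding y_def by (rule prod_cut_factors[OF P])
  qed
  also have "\<dots> = (\<Sum>Q | Q \<in> cut_space M \<and> P \<inter> Q = {}. (\<Prod>e\<in>edges M. 1 + (x e)\<^sup>2) *
        (\<Prod>e\<in>P. 2 / (1 + (x e)\<^sup>2)) * (\<Prod>e\<in>Q. (1 - (x e)\<^sup>2) / (1 + (x e)\<^sup>2)))"
    by (intro sum.mono_neutral_cong_right) auto
  also have "c * prod x P * (2 * \<dots>) =
      (\<Sum>Q | Q \<in> cut_space M \<and> P \<inter> Q = {}.
        c * (2 * (\<Prod>e\<in>edges M. 1 + (x e)\<^sup>2)) * loop_weight J P Q)"
    unfolding sum_distrib_left
  proof (intro sum.cong refl)
    fix Q
    have "prod x P * (\<Prod>e\<in>P. 2 / (1 + (x e)\<^sup>2)) = (\<Prod>e\<in>P. 2 * x e / (1 + (x e)\<^sup>2))"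
      unfolding prod.distrib[symmetric] by (intro prod.cong) auto
    then show "c * prod x P * (2 * ((\<Prod>e\<in>edges M. 1 + (x e)\<^sup>2) *
        (\<Prod>e\<in>P. 2 / (1 + (x e)\<^sup>2)) * (\<Prod>e\<in>Q. (1 - (x e)\<^sup>2) / (1 + (x e)\<^sup>2)))) =
        c * (2 * (\<Prod>e\<in>edges M. 1 + (x e)\<^sup>2)) * loop_weight J P Q"
      unfolding loop_weight_def x2[symmetric] x_def[symmetric] by (simp add: x_def ac_simps)
  qed
  also have "c * (2 * (\<Prod>e\<in>edges M. 1 + (x e)\<^sup>2)) = 2 ^ card (vertices M) * C_I M g J"
    unfolding c_def x2 by (rule C_I_constant[OF genus])
  finally show ?thesis by (simp add: sum_distrib_left[symmetric] mult.assoc)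
qed

end

section \<open>The two families of loops in the double Ising model\<close>

theorem proposition1:
  fixes M :: "('v, 'd) rotation_system"
    and g :: nat
    and J :: "'d set \<Rightarrow> real"
    and rep :: "'d set set set \<Rightarrow> 'd set set"
  assumes embedded: "embedded_graph M"
    and genus: "has_genus M g"
    and J_pos: "\<And>e. e \<in> edges (dual M) \<Longrightarrow> J e > 0"
    and rep: "\<And>\<epsilon>. \<epsilon> \<in> carrier (H1 M) \<Longrightarrow> rep \<epsilon> \<in> polygons M \<epsilon>"
  shows "Z_dIsing M J rep =
      C_I M g J *
        (\<Sum>(P, Q) \<in> {(P, Q) \<in> polygons M \<one>\<^bsub>H1 M\<^esub> \<times> polygons (dual M) \<one>\<^bsub>H1 (dual M)\<^esub>.
                      P \<inter> Q = {}}. loop_weight J P Q)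
    \<and> (\<forall>P \<in> polygons M \<one>\<^bsub>H1 M\<^esub>.
        (\<Sum>Q \<in> {Q \<in> polygons (dual M) \<one>\<^bsub>H1 (dual M)\<^esub>. P \<inter> Q = {}}. C_I M g J * loop_weight J P Q)
        = XOR_contribution M J rep P)"
proof -
  interpret embedded_graph M by (rule embedded)
  interpret D: embedded_graph "dual M" by (rule embedded_graph_dual)
  note zero = polygons_zero D.polygons_zero boundaries_dual
  have XOR: "XOR_contribution M J rep P =
      (\<Sum>Q | Q \<in> cut_space M \<and> P \<inter> Q = {}. C_I M g J * loop_weight J P Q)"
    if "P \<in> boundaries M" for P
  proof -
    have "P \<subseteq> edges M" using polygon_config_boundary[OF that] by (simp add: polygon_config_def)
    then have "(\<Sum>A | polygon_config M A. pair_weight J A (sym_diff A P)) =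
        (\<Sum>Q | Q \<in> cut_space M \<and> P \<inter> Q = {}. C_I M g J * loop_weight J P Q)"
      by (rule sum_pair_weight[OF genus])
    then show ?thesis using XOR_contribution_eq[where rep = rep, OF rep that] by simp
  qed
  have "Z_dIsing M J rep = (\<Sum>P\<in>boundaries M. XOR_contribution M J rep P)"
    by (rule Z_dIsing_eq_sum_XOR[OF rep])
  also have "\<dots> = (\<Sum>P\<in>boundaries M. \<Sum>Q | Q \<in> cut_space M \<and> P \<inter> Q = {}.
      C_I M g J * loop_weight J P Q)"
    by (intro sum.cong refl XOR)
  also have "\<dots> = (\<Sum>(P, Q) \<in> (SIGMA P : boundaries M. {Q \<in> cut_space M. P \<inter> Q = {}}).
      C_I M g J * loop_weight J P Q)"
    by (rule sum.Sigma) (auto intro: finite_boundaries)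
  also have "(SIGMA P : boundaries M. {Q \<in> cut_space M. P \<inter> Q = {}}) =
      {(P, Q) \<in> boundaries M \<times> cut_space M. P \<inter> Q = {}}"
    by auto
  finally show ?thesis
    unfolding zero by (simp add: XOR sum_distrib_left case_prod_unfold)
qed

end
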